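(* Let $T\neq P_n$ be a tree on $n$ vertices with diameter $D$. Among all diametric paths of $T$ (with both orientations), choose $P=v_0v_1\ldots v_D$ so that the first branching vertex on $P$ (counting from $v_0$) is as far as possible from $v_0$, and let $v_i$ be this first branching vertex. If $D>2$, $i=1$ and $\deg(v_{2})>2$, let $u=v_{2}$; otherwise let $u=v_i$. Let $w_1,\ldots,w_k$ be $k$ neighbors of $u$ not lying on $P$, where $1\leq k\leq \deg(u)-2$. Let $T'$ be the tree obtained from $T$ by deleting the edges $uw_1,\ldots,uw_k$ and adding the edges $v_0w_1,\ldots,v_0w_k$. Then $\xi^{ac}(T)>\xi^{ac}(T')$.
   Context: All graphs are simple and connected. $d(u,v)$ is the distance, $\varepsilon(u)=\max_v d(u,v)$ the eccentricity, and the diameter $D$ the maximum distance. A path $v_0\ldots v_D$ with $d(v_0,v_D)=D$ is diametric. A vertex of a tree is branching if its degree is at least $3$. $M(u)$ is the product of the degrees of all neighbors of $u$, and $\xi^{ac}(G)=\sum_{u\in V(G)}\frac{M(u)}{\varepsilon(u)}$. $P_n$ is the path on $n$ vertices. *)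

theory Defs
  imports "Graph_Theory.Graph_Theory"
begin

text \<open>
  A finite simple undirected graph is a \<open>pair_graph\<close>: a finite, loop-free digraph with a symmetric
  set of arcs. Each edge \<open>{x, y}\<close> is the pair of arcs \<open>(x, y)\<close>, \<open>(y, x)\<close>, so the degree of a
  vertex is its \<open>out_degree\<close>.
\<close>

abbreviation degree :: "('a, 'b) pre_digraph \<Rightarrow> 'a \<Rightarrow> nat" where
  "degree G v \<equiv> out_degree G v"

definition neighbors :: "('a, 'b) pre_digraph \<Rightarrow> 'a \<Rightarrow> 'a set" where
  "neighbors G v = {w. v \<rightarrow>\<^bsub>G\<^esub> w}"

text \<open>
  The library predicate \<open>tree\<close> is not usable here: in a symmetric digraph, traversing an edge back
  and forth counts as a \<open>cycle\<close> of length 2. Cycles of an undirected graph have length at least 3.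
\<close>

definition undirected_tree :: "'a pair_pre_digraph \<Rightarrow> bool" where
  "undirected_tree T \<longleftrightarrow>
     pair_graph T \<and> connected T \<and> \<not> (\<exists>p. pre_digraph.cycle T p \<and> 3 \<le> length p)"

definition path_graph :: "nat \<Rightarrow> nat pair_pre_digraph" where
  "path_graph n =
     \<lparr> pverts = {..<n}, parcs = {(i, j). i < n \<and> j < n \<and> (j = Suc i \<or> i = Suc j)} \<rparr>"

definition distance :: "('a, 'b) pre_digraph \<Rightarrow> 'a \<Rightarrow> 'a \<Rightarrow> nat" where
  "distance G u v = (LEAST l. \<exists>p. vwalk p G \<and> hd p = u \<and> last p = v \<and> vwalk_length p = l)"

definition eccentricity :: "('a, 'b) pre_digraph \<Rightarrow> 'a \<Rightarrow> nat" where
  "eccentricity G u = Max {distance G u v | v. v \<in> verts G}"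

definition graph_diameter :: "('a, 'b) pre_digraph \<Rightarrow> nat" where
  "graph_diameter G = Max {distance G u v | u v. u \<in> verts G \<and> v \<in> verts G}"

definition diametric_path :: "('a, 'b) pre_digraph \<Rightarrow> 'a vwalk \<Rightarrow> bool" where
  "diametric_path G p \<longleftrightarrow>
     vpath p G \<and> vwalk_length p = graph_diameter G \<and> distance G (hd p) (last p) = graph_diameter G"

definition branching :: "('a, 'b) pre_digraph \<Rightarrow> 'a \<Rightarrow> bool" where
  "branching G v \<longleftrightarrow> 3 \<le> degree G v"

text \<open>
  The index on \<open>p\<close> of its first branching vertex; meaningful if \<open>p\<close> contains a branching vertex,
  as every diametric path of a tree other than a path graph does. On a diametric path the index of
  a vertex is its distance from the first vertex.
\<close>

definition first_branching :: "('a, 'b) pre_digraph \<Rightarrow> 'a vwalk \<Rightarrow> nat" where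
  "first_branching G p = (LEAST i. i < length p \<and> branching G (p ! i))"

definition M :: "('a, 'b) pre_digraph \<Rightarrow> 'a \<Rightarrow> nat" where
  "M G u = (\<Prod>v\<in>neighbors G u. degree G v)"

definition xi_ac :: "('a, 'b) pre_digraph \<Rightarrow> real" where
  "xi_ac G = (\<Sum>u\<in>verts G. real (M G u) / real (eccentricity G u))"

definition move_edges :: "'a pair_pre_digraph \<Rightarrow> 'a \<Rightarrow> 'a \<Rightarrow> 'a set \<Rightarrow> 'a pair_pre_digraph" where
  "move_edges T u v W =
     \<lparr> pverts = pverts T,
       parcs = (parcs T - ({u} \<times> W \<union> W \<times> {u})) \<union> ({v} \<times> W \<union> W \<times> {v}) \<rparr>"

end

theory Submission
  imports Defs
begin

text \<open>
  In a tree, \<open>\<epsilon>(x) = max (d(x, v\<^sub>0)) (d(x, v\<^sub>D))\<close> by the four-point condition, and since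
  the moved branches hang at \<open>v\<^sub>0\<close> afterwards, no eccentricity decreases. It therefore suffices
  to compare the products \<open>M\<close>, weighted by the old eccentricities. Only \<open>M(v\<^sub>0)\<close> and \<open>M(v\<^sub>1)\<close> can
  grow, because all neighbors of \<open>v\<^sub>1\<close> except \<open>v\<^sub>2\<close> are leaves. The growth at \<open>v\<^sub>0\<close> is outweighed
  by the loss at \<open>u\<close> and the growth at \<open>v\<^sub>1\<close> by the losses at the neighbors of \<open>u\<close>, whose
  eccentricities are small enough. The maximality of \<open>P\<close> serves only to exclude \<open>D = 3\<close> when \<open>i = 1\<close>
  and \<open>deg v\<^sub>2 = 2\<close>.
\<close>

section \<open>Distances in connected graphs\<close>

text \<open>Relational powers replace lists of vertices, so that distances can be treated by
  induction on the length.\<close>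

lemma (in pair_wf_digraph) vwalk_relpow_iff:
  assumes "u \<in> pverts G"
  shows "(\<exists>p. vwalk p G \<and> hd p = u \<and> last p = v \<and> vwalk_length p = l) \<longleftrightarrow> (u, v) \<in> parcs G ^^ l"
  using assms
proof (induction l arbitrary: u)
  case 0
  have "vwalk [u] G" using 0 by (auto simp: vwalk_def)
  moreover have "u = v" if "vwalk p G" "hd p = u" "last p = v" "length p - 1 = 0" for p
    using that by (cases p) (auto simp: vwalk_def)
  ultimately show ?case by (force intro: exI[of _ "[u]"])
next
  case (Suc l)
  show ?case
  proof
    assume "\<exists>p. vwalk p G \<and> hd p = u \<and> last p = v \<and> vwalk_length p = Suc l"
    then obtain p where p: "vwalk p G" "hd p = u" "last p = v" "length p = Suc (Suc l)"
      by auto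
    then obtain q where q: "p = u # q" "length q = Suc l" by (cases p) auto
    then have ne: "q \<noteq> []" by auto
    have *: "(u, hd q) \<in> parcs G" "vwalk q G"
      using p(1) ne unfolding q by (auto elim: vwalk_consE)
    then have "(hd q, v) \<in> parcs G ^^ l"
      using Suc.IH[of "hd q"] p q ne in_arcsD2 by (auto intro!: exI[of _ q])
    then show "(u, v) \<in> parcs G ^^ Suc l" using * relpow_Suc_I2 by metis
  next
    assume "(u, v) \<in> parcs G ^^ Suc l"
    then obtain w where w: "(u, w) \<in> parcs G" "(w, v) \<in> parcs G ^^ l"
      by (meson relpow_Suc_D2)
    then obtain q where q: "vwalk q G" "hd q = w" "last q = v" "vwalk_length q = l"
      using Suc.IH[of w] in_arcsD2 by auto
    have ne: "q \<noteq> []" using q by auto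
    have "vwalk (u # q) G" using q w Suc.prems by (intro vwalk_consI) auto
    moreover have "vwalk_length (u # q) = Suc l" using q ne by (cases q) auto
    ultimately show "\<exists>p. vwalk p G \<and> hd p = u \<and> last p = v \<and> vwalk_length p = Suc l"
      using q ne by (intro exI[of _ "u # q"]) auto
  qed
qed

lemma (in pair_wf_digraph) distance_eq_Least_relpow:
  "u \<in> pverts G \<Longrightarrow> distance G u v = (LEAST l. (u, v) \<in> parcs G ^^ l)"
  unfolding distance_def by (simp only: vwalk_relpow_iff)

lemma (in pair_wf_digraph) vwalk_arcs_awalk:
  assumes "vwalk p G"
  shows "awalk (hd p) (vwalk_arcs p) (last p) \<and> pawalk_verts (hd p) (vwalk_arcs p) = p"
  using assms
proof (induction p rule: vwalk_induct)
  case (Base u)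
  then show ?case by (auto simp: awalk_Nil_iff)
next
  case (Cons u v es)
  then show ?case by (auto simp: awalk_Cons_iff)
qed

text \<open>Links geodesics, which are lists of vertices, to the arc-based \<open>cycle\<close>. The
  length is tracked because only cycles of length at least 3 are excluded in a tree.\<close>

lemma (in pair_wf_digraph) cycle_of_vpath:
  assumes "vpath p G" and "(last p, hd p) \<in> parcs G"
  shows "\<exists>c. cycle c \<and> length c = length p"
proof -
  let ?q = "p @ [hd p]"
  have ne: "p \<noteq> []" and w: "vwalk p G" and dis: "distinct p"
    using assms(1) by (auto simp: vpath_def vwalk_def)
  have q: "vwalk ?q G"
    using w assms(2) ne set_vwalk_arcs_snoc[OF ne, of "hd p"]
    by (auto simp: vwalk_def)
  have "awalk (hd p) (vwalk_arcs ?q) (hd p)" "pawalk_verts (hd p) (vwalk_arcs ?q) = ?q"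
    using vwalk_arcs_awalk[OF q] ne by simp_all
  moreover have "length (vwalk_arcs ?q) = length p"
    using vwalk_length_simp[of ?q] unfolding vwalk_length_def by simp
  moreover have "distinct (tl ?q)" using dis ne by (cases p) auto
  moreover have "vwalk_arcs ?q \<noteq> []" using \<open>length (vwalk_arcs ?q) = length p\<close> ne by auto
  ultimately show ?thesis unfolding cycle_def
    by (intro exI[of _ "vwalk_arcs ?q"] conjI exI[of _ "hd p"]) auto
qed

lemma degree_eq_card_neighbors: "degree (with_proj G) x = card (neighbors (with_proj G) x)"
proof -
  have "out_arcs (with_proj G) x = Pair x ` neighbors (with_proj G) x"
    by (auto simp: neighbors_def out_arcs_def)
  then show ?thesis unfolding out_degree_def by (simp add: card_image inj_on_def)
qed

text \<open>Distances are developed for connected graphs so that they apply to the graph after the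
  move as well as to the tree.\<close>

locale connected_pair_graph = pair_graph +
  assumes reachable_arcs: "x \<in> pverts G \<Longrightarrow> y \<in> pverts G \<Longrightarrow> (x, y) \<in> (parcs G)\<^sup>*"
begin

abbreviation d :: "'a \<Rightarrow> 'a \<Rightarrow> nat" where "d \<equiv> distance (with_proj G)"
abbreviation N :: "'a \<Rightarrow> 'a set" where "N \<equiv> neighbors (with_proj G)"

lemma in_N_iff: "y \<in> N x \<longleftrightarrow> (x, y) \<in> parcs G"
  by (simp add: neighbors_def)

lemma finite_N [simp]: "finite (N x)"
  by (rule finite_subset[of _ "pverts G"]) (auto simp: in_N_iff dest: in_arcsD2)

lemma N_sym: "y \<in> N x \<longleftrightarrow> x \<in> N y"
  using arcs_symmetric by (auto simp: in_N_iff)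

lemma N_irrefl [simp]: "x \<notin> N x"
  using no_loops' by (auto simp: in_N_iff)

lemma N_in_verts: "y \<in> N x \<Longrightarrow> y \<in> pverts G"
  using in_arcsD2 by (simp add: in_N_iff)

lemma card_N_ge_1: "y \<in> N x \<Longrightarrow> 1 \<le> card (N y)"
  using N_sym[of y x] by (auto simp: Suc_le_eq card_gt_0_iff)

lemma dist_relpow:
  assumes "x \<in> pverts G" "y \<in> pverts G"
  shows "(x, y) \<in> parcs G ^^ d x y"
proof -
  have "\<exists>l. (x, y) \<in> parcs G ^^ l"
    using reachable_arcs[OF assms] by (rule rtrancl_imp_relpow)
  then show ?thesis unfolding distance_eq_Least_relpow[OF assms(1)] by (rule LeastI_ex)
qed

lemma dist_le: "x \<in> pverts G \<Longrightarrow> (x, y) \<in> parcs G ^^ l \<Longrightarrow> d x y \<le> l"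
  by (simp add: distance_eq_Least_relpow Least_le)

lemma dist_self [simp]: "x \<in> pverts G \<Longrightarrow> d x x = 0"
  using dist_le[of x x 0] by simp

lemma dist_eq_0_iff: "x \<in> pverts G \<Longrightarrow> y \<in> pverts G \<Longrightarrow> d x y = 0 \<longleftrightarrow> x = y"
  using dist_relpow[of x y] by auto

lemma dist_triangle:
  assumes "x \<in> pverts G" "y \<in> pverts G" "z \<in> pverts G"
  shows "d x z \<le> d x y + d y z"
  using assms dist_relpow[of x y] dist_relpow[of y z] by (intro dist_le) (auto simp: relpow_add)

lemma dist_commute:
  assumes "x \<in> pverts G" "y \<in> pverts G"
  shows "d x y = d y x"
proof -
  have rev: "(b, a) \<in> parcs G ^^ l" if "(a, b) \<in> parcs G ^^ l" for a b l
    using that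
  proof (induction l arbitrary: a)
    case (Suc l)
    then obtain c where "(a, c) \<in> parcs G" "(c, b) \<in> parcs G ^^ l" by (meson relpow_Suc_D2)
    then show ?case using Suc.IH arcs_symmetric by (meson relpow_Suc_I)
  qed simp
  have "d a b \<le> d b a" if "a \<in> pverts G" "b \<in> pverts G" for a b
    using dist_le[OF that(1) rev[OF dist_relpow]] that by simp
  then show ?thesis using assms by (simp add: order_antisym)
qed

lemma dist_adjacent: "(x, y) \<in> parcs G \<Longrightarrow> d x y = 1"
proof -
  assume e: "(x, y) \<in> parcs G"
  then have "d x y \<le> 1" using in_arcsD1 by (intro dist_le) auto
  moreover have "d x y \<noteq> 0" using e dist_eq_0_iff in_arcsD1 in_arcsD2 no_loops' by blast
  ultimately show ?thesis by simp
qed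

lemma dist_adjacent_le: "(x, y) \<in> parcs G \<Longrightarrow> z \<in> pverts G \<Longrightarrow> d x z \<le> Suc (d y z)"
  using dist_triangle[of x y z] dist_adjacent[of x y] in_arcsD1 in_arcsD2 by fastforce

lemma dist_SucE:
  assumes "x \<in> pverts G" "y \<in> pverts G" "d x y = Suc n"
  obtains z where "(x, z) \<in> parcs G" "d z y = n"
proof -
  obtain z where z: "(x, z) \<in> parcs G" "(z, y) \<in> parcs G ^^ n"
    using dist_relpow[OF assms(1,2)] assms(3) by (metis relpow_Suc_D2)
  have "d z y \<le> n" using z in_arcsD2 by (intro dist_le) auto
  moreover have "Suc n \<le> Suc (d z y)" using dist_adjacent_le[OF z(1) assms(2)] assms(3) by simp
  ultimately show ?thesis using that z by simp
qed

text \<open>A potential that changes by at most 1 along each edge bounds distances from below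
  without any knowledge of the geodesics.\<close>

lemma lipschitz_le_dist:
  fixes f :: "'a \<Rightarrow> nat"
  assumes "\<And>a b. (a, b) \<in> parcs G \<Longrightarrow> f a \<le> Suc (f b)" and "x \<in> pverts G" "y \<in> pverts G"
  shows "f x \<le> f y + d x y"
proof -
  have "f x \<le> f y + l" if "(x, y) \<in> parcs G ^^ l" for l
    using that
  proof (induction l arbitrary: x)
    case (Suc l)
    then obtain c where "(x, c) \<in> parcs G" "(c, y) \<in> parcs G ^^ l" by (meson relpow_Suc_D2)
    then show ?case using assms(1)[of x c] Suc.IH[of c] by simp
  qed auto
  then show ?thesis using dist_relpow assms by blast
qed

text \<open>Repeatedly steps to a neighbor that is closer to \<open>y\<close>. The equation for
  intermediate vertices serves to show that two geodesics are disjoint.\<close>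

lemma geodesic_exists:
  assumes "x \<in> pverts G" "y \<in> pverts G"
  shows "\<exists>p. vpath p G \<and> hd p = x \<and> last p = y \<and> length p = Suc (d x y) \<and>
    (\<forall>z\<in>set p. d x z + d z y = d x y)"
  using assms
proof (induction "d x y" arbitrary: x)
  case 0
  then have "x = y" by (simp add: dist_eq_0_iff)
  then show ?case using 0 by (intro exI[of _ "[x]"]) (auto simp: vpath_def vwalk_def)
next
  case (Suc n)
  obtain z where z: "(x, z) \<in> parcs G" "d z y = n"
    using dist_SucE[OF Suc.prems Suc.hyps(2)[symmetric]] .
  then have zV: "z \<in> pverts G" using in_arcsD2 by blast
  obtain q where q: "vpath q G" "hd q = z" "last q = y" "length q = Suc (d z y)"
    "\<forall>w\<in>set q. d z w + d w y = d z y"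
    using Suc.hyps(1)[of z] z zV Suc.prems by auto
  have ne: "q \<noteq> []" using q(4) by auto
  have wV: "w \<in> pverts G" if "w \<in> set q" for w using q(1) that by (auto simp: vpath_def vwalk_def)
  have "x \<notin> set q" using q(5) z(2) Suc.hyps(2) by force
  moreover have "vwalk (x # q) G"
    using q z Suc.prems by (intro vwalk_consI) (auto simp: vpath_def)
  moreover have "d x w + d w y = d x y" if "w \<in> set q" for w
  proof -
    have "d x w \<le> Suc (d z w)" using dist_adjacent_le z wV that by simp
    moreover have "d x y \<le> d x w + d w y" using dist_triangle Suc.prems wV that by simp
    ultimately show ?thesis using q(5) that z(2) Suc.hyps(2) by fastforce
  qed
  ultimately show ?case using q z Suc.prems Suc.hyps(2) ne
    by (intro exI[of _ "x # q"]) (auto simp: vpath_def)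
qed

lemma finite_dists: "finite {d x y | y. y \<in> pverts G}"
  using pair_finite_verts by simp

lemma dist_le_eccentricity: "y \<in> pverts G \<Longrightarrow> d x y \<le> eccentricity G x"
  unfolding eccentricity_def by (rule Max_ge) (use finite_dists in auto)

lemma eccentricity_le:
  assumes "\<And>y. y \<in> pverts G \<Longrightarrow> d x y \<le> b" and "pverts G \<noteq> {}"
  shows "eccentricity G x \<le> b"
  unfolding eccentricity_def by (rule Max.boundedI) (use finite_dists assms in auto)

lemma dist_le_diameter: "x \<in> pverts G \<Longrightarrow> y \<in> pverts G \<Longrightarrow> d x y \<le> graph_diameter G"
proof -
  have "finite {d x y | x y. x \<in> pverts G \<and> y \<in> pverts G}"
    by (rule finite_image_set2) (use pair_finite_verts in simp_all)
  then show "x \<in> pverts G \<Longrightarrow> y \<in> pverts G \<Longrightarrow> d x y \<le> graph_diameter G"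
    unfolding graph_diameter_def by (intro Max_ge) auto
qed

end

section \<open>Trees\<close>

locale tree_graph = connected_pair_graph +
  assumes acyclic: "\<not> (\<exists>p. cycle p \<and> 3 \<le> length p)"
begin

text \<open>
  The geodesics from \<open>x\<close> to \<open>a\<close> and from \<open>y\<close> to \<open>b\<close> are disjoint, so together with the edges \<open>ab\<close>
  and \<open>xy\<close> they would close up to a cycle.
\<close>
lemma edge_cut:
  assumes ab: "(a, b) \<in> parcs G" and xy: "(x, y) \<in> parcs G"
    and x: "d x a < d x b" and y: "d y b \<le> d y a"
  shows "x = a \<and> y = b"
proof (rule ccontr)
  assume neq: "\<not> (x = a \<and> y = b)"
  have V: "a \<in> pverts G" "b \<in> pverts G" "x \<in> pverts G" "y \<in> pverts G"
    using ab xy in_arcsD1 in_arcsD2 by blast+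
  obtain p where p: "vpath p G" "hd p = a" "last p = x" "length p = Suc (d a x)"
    "\<forall>z\<in>set p. d a z + d z x = d a x"
    using geodesic_exists[of a x] V by blast
  obtain q where q: "vpath q G" "hd q = y" "last q = b" "length q = Suc (d y b)"
    "\<forall>z\<in>set q. d y z + d z b = d y b"
    using geodesic_exists[of y b] V by blast
  have ne: "p \<noteq> []" "q \<noteq> []" using p(4) q(4) by auto
  have "z \<notin> set q" if zp: "z \<in> set p" for z
  proof
    assume zq: "z \<in> set q"
    have zV: "z \<in> pverts G" using p(1) zp by (auto simp: vpath_def vwalk_def)
    have "d a z + d z x = d a x" "d y z + d z b = d y b" using p(5) q(5) zp zq by auto
    moreover have "d x b \<le> d x z + d z b" "d y a \<le> d y z + d z a"
      using dist_triangle V zV by auto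
    moreover have "d x z = d z x" "d a z = d z a" "d a x = d x a"
      using dist_commute V zV by auto
    ultimately show False using x y by linarith
  qed
  then have "distinct (p @ q)" using p(1) q(1) by (auto simp: vpath_def)
  moreover have "vwalk (p @ q) G"
    using p q xy ne by (auto simp: vwalk_def vpath_def vwalk_arcs_append)
  ultimately have "vpath (p @ q) G" by (simp add: vpath_def)
  moreover have "(last (p @ q), hd (p @ q)) \<in> parcs G" using p q ne ab arcs_symmetric by simp
  ultimately obtain c where "cycle c" "length c = length (p @ q)" using cycle_of_vpath by blast
  then have "length p + length q < 3" using acyclic by (metis length_append not_le)
  \<comment> \<open>Both geodesics are nonempty, so a total length below 3 makes each a single
    vertex.\<close>
  then have "d a x = 0" "d y b = 0" using p(4) q(4) by auto
  then show False using neq V by (simp add: dist_eq_0_iff)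
qed

text \<open>The ends of an edge never tie. For the next vertex \<open>z'\<close> on a geodesic from
  \<open>z\<close> to \<open>a\<close>, either the induction hypothesis applies, or the edge between
  \<open>z\<close> and \<open>z'\<close> crosses the cut and is \<open>ab\<close> itself.\<close>

lemma edge_dist_Suc:
  assumes ab: "(a, b) \<in> parcs G" and z: "z \<in> pverts G" and le: "d z b \<le> d z a"
  shows "d z a = Suc (d z b)"
  using z le
proof (induction "d z a" arbitrary: z)
  case 0
  have "a \<in> pverts G" "b \<in> pverts G" using ab in_arcsD1 in_arcsD2 by blast+
  then have "z = a" "z = b" using 0 by (simp_all add: dist_eq_0_iff)
  then show ?case using ab no_loops' by blast
next
  case (Suc n)
  have V: "a \<in> pverts G" "b \<in> pverts G" using ab in_arcsD1 in_arcsD2 by blast+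
  obtain z' where z': "(z, z') \<in> parcs G" "d z' a = n"
    using dist_SucE[OF Suc.prems(1) V(1) Suc.hyps(2)[symmetric]] .
  have z'V: "z' \<in> pverts G" using z' in_arcsD2 by blast
  show ?case
  proof (cases "d z' b \<le> d z' a")
    case True
    then have "d z' a = Suc (d z' b)" using Suc.hyps(1)[of z'] z' z'V by simp
    moreover have "d z b \<le> Suc (d z' b)" using dist_adjacent_le z' V by simp
    moreover have "d z a \<le> d z b + d b a" "d b a = 1"
      using dist_triangle[of z b a] Suc.prems V dist_adjacent ab arcs_symmetric by auto
    ultimately show ?thesis using Suc.hyps(2) z' by simp
  next
    case False
    then have "z' = a \<and> z = b"
      using edge_cut[OF ab, of z' z] z' Suc.prems arcs_symmetric by auto
    then show ?thesis using V dist_adjacent ab arcs_symmetric by simp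
  qed
qed

lemma edge_dist_cases:
  assumes "(a, b) \<in> parcs G" "z \<in> pverts G"
  obtains "d z a = Suc (d z b)" | "d z b = Suc (d z a)"
  using edge_dist_Suc[OF assms] edge_dist_Suc[of b a z] assms arcs_symmetric nat_le_linear by metis

text \<open>On a geodesic from \<open>x\<close> to \<open>y\<close>, the first edge leaving the side
  of \<open>a\<close> is \<open>ab\<close> by \<open>edge_cut\<close>.\<close>

lemma dist_through_edge:
  assumes ab: "(a, b) \<in> parcs G" and "x \<in> pverts G" and y: "y \<in> pverts G"
    and "d x a < d x b" and yb: "d y b < d y a"
  shows "d x y = d x a + 1 + d b y"
  using assms(2,4)
proof (induction "d x y" arbitrary: x)
  case 0
  then show ?case using y yb by (simp add: dist_eq_0_iff)
next
  case (Suc n)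
  have V: "a \<in> pverts G" "b \<in> pverts G" using ab in_arcsD1 in_arcsD2 by blast+
  obtain x' where x': "(x, x') \<in> parcs G" "d x' y = n"
    using dist_SucE[OF Suc.prems(1) y Suc.hyps(2)[symmetric]] .
  have x'V: "x' \<in> pverts G" using x' in_arcsD2 by blast
  show ?case
  proof (cases "d x' a < d x' b")
    case True
    then have "n = d x' a + 1 + d b y" using Suc.hyps(1)[of x'] x' x'V by simp
    moreover have "d x a \<le> Suc (d x' a)" using dist_adjacent_le x' V by simp
    moreover have "d x y \<le> d x a + d a y" "d a y \<le> Suc (d b y)"
      using dist_triangle Suc.prems V y dist_adjacent_le ab by auto
    ultimately show ?thesis using Suc.hyps(2) by simp
  next
    case False
    then have "x = a \<and> x' = b"
      using edge_cut[OF ab x'(1)] Suc.prems by auto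
    then show ?thesis using V x' Suc.hyps(2) by simp
  qed
qed

text \<open>If \<open>b\<close> and \<open>c\<close> differ, then \<open>c\<close> lies on the side
  of \<open>a\<close> with respect to the edge \<open>ab\<close>. The distance from \<open>c\<close>
  to \<open>z\<close> is then realized through \<open>a\<close>, so \<open>c\<close> is farther from
  \<open>z\<close> than \<open>a\<close>.\<close>

lemma closer_neighbor_unique:
  assumes "(a, b) \<in> parcs G" "(a, c) \<in> parcs G" "z \<in> pverts G"
    and "d z b < d z a" "d z c < d z a"
  shows "b = c"
proof (rule ccontr)
  assume "b \<noteq> c"
  have V: "a \<in> pverts G" "b \<in> pverts G" "c \<in> pverts G" using assms in_arcsD1 in_arcsD2 by blast+
  have ca: "d c a = 1" using dist_adjacent assms(2) arcs_symmetric by blast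
  have "d c b \<noteq> 0" using \<open>b \<noteq> c\<close> V by (simp add: dist_eq_0_iff)
  then have "d c a < d c b" using edge_dist_cases[OF assms(1) V(3)] ca by force
  then have "d c z = d c a + 1 + d b z"
    by (rule dist_through_edge[OF assms(1) V(3) assms(3) _ assms(4)])
  moreover have "d z a = Suc (d z b)" "d z a = Suc (d z c)"
    using edge_dist_Suc[OF assms(1,3)] edge_dist_Suc[OF assms(2,3)] assms(4,5) by simp_all
  ultimately show False using dist_commute[of z] V assms(3) ca by simp
qed

text \<open>Induction moves \<open>p\<close> one edge towards \<open>q\<close>. If \<open>x\<close>
  and \<open>y\<close> both lie beyond that edge, both sides change by 1. If one of them lies on the
  side of \<open>p\<close>, its distance to \<open>q\<close> splits at \<open>p\<close>, and the
  triangle inequality through \<open>p\<close> suffices.\<close>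

lemma four_point:
  assumes "p \<in> pverts G" "q \<in> pverts G" "x \<in> pverts G" "y \<in> pverts G"
  shows "d x y + d p q \<le> max (d x p + d y q) (d x q + d y p)"
  using assms(1)
proof (induction "d p q" arbitrary: p)
  case 0
  then have "p = q" using assms by (simp add: dist_eq_0_iff)
  then show ?case using dist_triangle[of x q y] dist_commute[of q y] assms by simp
next
  case (Suc n)
  obtain p' where p': "(p, p') \<in> parcs G" "d p' q = n"
    using dist_SucE[OF Suc.prems assms(2) Suc.hyps(2)[symmetric]] .
  have p'V: "p' \<in> pverts G" using p' in_arcsD2 by blast
  have q: "d q p' < d q p" using p' Suc.hyps(2) dist_commute p'V assms Suc.prems by simp
  have pass: "d z q = d z p + d p q" if "z \<in> pverts G" "d z p < d z p'" for z
    using dist_through_edge[OF p'(1) that(1) assms(2) that(2) q] p' Suc.hyps(2) by simp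
  have tri: "d x y \<le> d x p + d y p"
    using dist_triangle[of x p y] dist_commute[of p y] assms Suc.prems by simp
  show ?case
  proof (cases "d x p < d x p' \<or> d y p < d y p'")
    case True
    then show ?thesis using pass[of x] pass[of y] tri assms by fastforce
  next
    case False
    then have "d x p = Suc (d x p')" "d y p = Suc (d y p')"
      using edge_dist_Suc[OF p'(1)] assms by auto
    moreover have "d x y + d p' q \<le> max (d x p' + d y q) (d x q + d y p')"
      using Suc.hyps(1)[of p'] p' p'V by simp
    ultimately show ?thesis using p' Suc.hyps(2) by simp
  qed
qed

lemma farther_neighbor:
  assumes "(a, b) \<in> parcs G" "(a, c) \<in> parcs G" "z \<in> pverts G" "d z b < d z a" "b \<noteq> c"
  shows "d z c = Suc (d z a)"
proof -
  have "\<not> d z c < d z a" using closer_neighbor_unique[OF assms(1-4)] assms(5) by blast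
  then show ?thesis
    using edge_dist_Suc[of c a z] assms(2,3) arcs_symmetric by simp
qed

end

section \<open>Diametric paths in a tree\<close>

locale tree_diametric = tree_graph +
  fixes v :: "nat \<Rightarrow> 'a" and D :: nat
  assumes v_edge: "a < D \<Longrightarrow> (v a, v (Suc a)) \<in> parcs G"
    and D_pos: "0 < D"
    and dist_ends: "d (v 0) (v D) = D"
    and dist_le_D: "x \<in> pverts G \<Longrightarrow> y \<in> pverts G \<Longrightarrow> d x y \<le> D"
begin

lemma v_in_verts: "a \<le> D \<Longrightarrow> v a \<in> pverts G"
  using v_edge[of a] v_edge[of "a - 1"] D_pos
  by (cases "a < D") (auto dest: in_arcsD1 in_arcsD2)

text \<open>The path splits into three segments of total length \<open>D\<close>; since its ends are
  at distance \<open>D\<close>, none of them can be shortened.\<close>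

lemma dist_v:
  assumes "a \<le> b" "b \<le> D"
  shows "d (v a) (v b) = b - a"
proof -
  have pow: "(v a, v (a + l)) \<in> parcs G ^^ l" if "a + l \<le> D" for a l
    using that
  proof (induction l)
    case (Suc l)
    then show ?case using v_edge[of "a + l"] by auto
  qed simp
  have le: "d (v a) (v b) \<le> b - a" if "a \<le> b" "b \<le> D" for a b
    using pow[of a "b - a"] v_in_verts[of a] that by (intro dist_le) auto
  have "D \<le> d (v 0) (v a) + (d (v a) (v b) + d (v b) (v D))"
    using dist_triangle[of "v 0" "v a" "v D"] dist_triangle[of "v a" "v b" "v D"]
      v_in_verts assms dist_ends by simp
  then show ?thesis using le[of 0 a] le[of b D] le[of a b] assms by simp
qed

lemma dist_v': "a \<le> D \<Longrightarrow> b \<le> D \<Longrightarrow> d (v a) (v b) = (if a \<le> b then b - a else a - b)"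
  using dist_v[of a b] dist_v[of b a] dist_commute[of "v a" "v b"] v_in_verts by auto

lemma v_eq_iff: "a \<le> D \<Longrightarrow> b \<le> D \<Longrightarrow> v a = v b \<longleftrightarrow> a = b"
  using dist_v'[of a b] dist_eq_0_iff[of "v a" "v b"] v_in_verts by (auto split: if_splits)

lemma v_adjacent_iff:
  "a \<le> D \<Longrightarrow> b \<le> D \<Longrightarrow> (v a, v b) \<in> parcs G \<longleftrightarrow> b = Suc a \<or> a = Suc b"
  using dist_v'[of a b] dist_adjacent[of "v a" "v b"] v_edge[of a] v_edge[of b]
    arcs_symmetric[of "v b" "v a"]
  by (auto split: if_splits)

text \<open>Transfers facts about the start of the path to its end.\<close>

lemma reverse: "tree_diametric G (\<lambda>a. v (D - a)) D"
proof unfold_locales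
  fix a assume "a < D"
  then show "(v (D - a), v (D - Suc a)) \<in> parcs G" by (auto simp: v_adjacent_iff)
next
  show "d (v (D - 0)) (v (D - D)) = D" using dist_v'[of D 0] by simp
qed (use D_pos dist_le_D in auto)

text \<open>In the four-point condition for \<open>x\<close>, \<open>y\<close> and the two ends, the
  distances from \<open>y\<close> to the ends are at most \<open>D\<close>, and \<open>D\<close>
  cancels.\<close>

lemma eccentricity_le_max:
  assumes "x \<in> pverts G"
  shows "eccentricity G x \<le> max (d x (v 0)) (d x (v D))"
proof (rule eccentricity_le)
  fix y assume y: "y \<in> pverts G"
  have "d x y + D \<le> max (d x (v 0) + d y (v D)) (d x (v D) + d y (v 0))"
    using four_point[of "v 0" "v D" x y] assms y v_in_verts dist_ends by simp
  moreover have "d y (v D) \<le> D" "d y (v 0) \<le> D" using dist_le_D y v_in_verts by auto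
  ultimately show "d x y \<le> max (d x (v 0)) (d x (v D))" by linarith
qed (use assms in auto)

lemma eccentricity_v_le: "a \<le> D \<Longrightarrow> eccentricity G (v a) \<le> max a (D - a)"
  using eccentricity_le_max[of "v a"] v_in_verts[of a] dist_v'[of a 0] dist_v'[of a D]
  by (auto split: if_splits)

lemma le_eccentricity_v: "a \<le> D \<Longrightarrow> D - a \<le> eccentricity G (v a)"
  using dist_le_eccentricity[of "v D" "v a"] v_in_verts[of D] dist_v'[of a D] by auto

lemma eccentricity_le_D: "x \<in> pverts G \<Longrightarrow> eccentricity G x \<le> D"
  using eccentricity_le_max[of x] dist_le_D v_in_verts by (meson le0 le_trans max.bounded_iff order_refl)

lemma eccentricity_pos:
  assumes "x \<in> pverts G"
  shows "0 < eccentricity G x"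
proof -
  have "v 0 \<noteq> v D" using v_eq_iff D_pos by simp
  then have "0 < d x (v 0) \<or> 0 < d x (v D)"
    using dist_eq_0_iff assms v_in_verts by (metis le0 neq0_conv order_refl)
  then show ?thesis
    using dist_le_eccentricity v_in_verts by (meson le0 less_le_trans order_refl)
qed

text \<open>A second neighbor of \<open>v 0\<close> would be at distance \<open>D + 1\<close> from
  \<open>v D\<close>.\<close>

lemma N_v_0: "N (v 0) = {v 1}"
proof (rule set_eqI, rule iffI)
  fix x assume "x \<in> N (v 0)"
  then have e: "(v 0, x) \<in> parcs G" by (simp add: in_N_iff)
  have V: "v D \<in> pverts G" "x \<in> pverts G" using e v_in_verts in_arcsD2 by auto
  have "d (v D) (v 0) = D" "d (v D) (v 1) = D - 1"
    using dist_v'[of D 0] dist_v'[of D 1] D_pos by auto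
  moreover have "(v 0, v 1) \<in> parcs G" using v_edge[of 0] D_pos by simp
  moreover have "d (v D) x \<le> D" using dist_le_D V by simp
  ultimately show "x \<in> {v 1}"
    using farther_neighbor[of "v 0" "v 1" x "v D"] e V D_pos by auto
next
  fix x assume "x \<in> {v 1}"
  then show "x \<in> N (v 0)" using v_edge[of 0] D_pos by (simp add: in_N_iff)
qed

lemma N_v_D: "N (v D) = {v (D - 1)}"
  using tree_diametric.N_v_0[OF reverse] by simp

text \<open>Like \<open>v 0\<close>, such an \<open>x\<close> is at distance \<open>D\<close> from
  \<open>v D\<close>, so a further neighbor would exceed the diameter.\<close>

lemma N_v_1_leaf:
  assumes "2 \<le> D" "(v 1, x) \<in> parcs G" "x \<noteq> v 2"
  shows "N x = {v 1}"
proof (rule set_eqI, rule iffI)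
  have V: "v D \<in> pverts G" "x \<in> pverts G" using assms v_in_verts in_arcsD2 by auto
  have "d (v D) (v 1) = D - 1" "d (v D) (v 2) = D - 2"
    using dist_v'[of D 1] dist_v'[of D 2] assms by auto
  moreover have "(v 1, v 2) \<in> parcs G" using v_edge[of 1] assms by (simp add: numeral_2_eq_2)
  ultimately have x: "d (v D) x = D" "d (v D) (v 1) < d (v D) x"
    using farther_neighbor[of "v 1" "v 2" x "v D"] assms V by auto
  fix y
  {
    assume "y \<in> N x"
    then have e: "(x, y) \<in> parcs G" by (simp add: in_N_iff)
    have "d (v D) y \<le> D" using dist_le_D V e in_arcsD2 by blast
    then show "y \<in> {v 1}"
      using farther_neighbor[of x "v 1" y "v D"] e V x assms arcs_symmetric by auto
  }
  {
    assume "y \<in> {v 1}"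
    then show "y \<in> N x" using assms arcs_symmetric by (simp add: in_N_iff)
  }
qed

lemma two_le_card_N_v:
  assumes "0 < a" "a < D"
  shows "2 \<le> card (N (v a))"
proof -
  have "{v (a - 1), v (Suc a)} \<subseteq> N (v a)" using assms by (auto simp: in_N_iff v_adjacent_iff)
  moreover have "card {v (a - 1), v (Suc a)} = 2" using assms by (simp add: v_eq_iff)
  ultimately show ?thesis by (metis card_mono finite_N)
qed

end

section \<open>Moving branches to an end of a diametric path\<close>

lemma M_eq_prod_card:
  "M (with_proj H) x = (\<Prod>y\<in>neighbors (with_proj H) x. card (neighbors (with_proj H) y))"
  unfolding M_def by (simp add: degree_eq_card_neighbors)

lemma prod_eq_two_factors:
  fixes f :: "'b \<Rightarrow> 'c :: comm_monoid_mult"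
  assumes "finite S" "a \<in> S" "b \<in> S" "a \<noteq> b" "\<And>y. y \<in> S \<Longrightarrow> y \<noteq> a \<Longrightarrow> y \<noteq> b \<Longrightarrow> f y = 1"
  shows "prod f S = f a * f b"
proof -
  have "prod f S = prod f {a, b}" using assms by (intro prod.mono_neutral_right) auto
  then show ?thesis using assms by simp
qed

text \<open>Treats both choices of \<open>u\<close> uniformly as \<open>v j\<close>, where
  \<open>j\<close> will be \<open>i\<close> or 2.\<close>

locale edge_move = tree_diametric +
  fixes j :: nat and W :: "'a set"
  assumes j_pos: "0 < j" and j_less: "j < D"
    and W_adj: "w \<in> W \<Longrightarrow> (v j, w) \<in> parcs G"
    and W_off: "a \<le> D \<Longrightarrow> v a \<notin> W"
    and W_ne: "W \<noteq> {}"
    and card_W: "card W + 2 \<le> card (N (v j))"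
begin

abbreviation u :: 'a where "u \<equiv> v j"
abbreviation G' :: "'a pair_pre_digraph" where "G' \<equiv> move_edges G u (v 0) W"
abbreviation N' :: "'a \<Rightarrow> 'a set" where "N' \<equiv> neighbors (with_proj G')"

text \<open>The vertices of the branches that are moved.\<close>
definition B :: "'a set" where "B = {x \<in> pverts G. \<exists>w\<in>W. d x w < d x u}"

lemma u_in_verts [simp]: "u \<in> pverts G"
  using v_in_verts[of j] j_less by simp

lemma v_0_in_verts [simp]: "v 0 \<in> pverts G"
  using v_in_verts[of 0] by simp

lemma v_D_in_verts [simp]: "v D \<in> pverts G"
  using v_in_verts[of D] by simp

lemma W_subset: "w \<in> W \<Longrightarrow> w \<in> pverts G"
  using W_adj in_arcsD2 by blast

lemma W_subset_N: "W \<subseteq> N u"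
  using W_adj by (auto simp: in_N_iff)

lemma finite_W [simp]: "finite W"
  using W_subset_N finite_N finite_subset by blast

lemma u_not_in_B: "u \<notin> B"
  by (simp add: B_def)

lemma W_subset_B: "w \<in> W \<Longrightarrow> w \<in> B"
  using W_subset[of w] dist_adjacent[of w u] W_adj[of w] arcs_symmetric by (force simp: B_def)

text \<open>A vertex of \<open>B\<close> lies on the side of \<open>w\<close> for some edge
  \<open>wu\<close> with \<open>w\<close> in \<open>W\<close>. An edge leaving \<open>B\<close>
  crosses this cut and hence equals \<open>wu\<close>.\<close>

lemma B_boundary:
  assumes "(x, y) \<in> parcs G" "x \<in> B" "y \<notin> B"
  shows "x \<in> W \<and> y = u"
proof -
  obtain w where w: "w \<in> W" "d x w < d x u" using assms(2) by (auto simp: B_def)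
  then have "d y u \<le> d y w" using assms(1,3) in_arcsD2 by (force simp: B_def)
  then show ?thesis using edge_cut[of w u x y] W_adj w arcs_symmetric assms(1) by blast
qed

lemma v_not_in_B:
  assumes "a \<le> D"
  shows "v a \<notin> B"
proof
  assume "v a \<in> B"
  then obtain w where w: "w \<in> W" "d (v a) w < d (v a) u" by (auto simp: B_def)
  \<comment> \<open>The neighbor of \<open>u\<close> on the path in the direction of
    \<open>v a\<close>; by uniqueness of the closer neighbor it would have to be
    \<open>w\<close>.\<close>
  define b where "b = (if a < j then j - 1 else Suc j)"
  have "a \<noteq> j" using w(2) by auto
  then have "b \<le> D" "(u, v b) \<in> parcs G" "d (v a) (v b) < d (v a) u"
    using assms j_less by (auto simp: b_def dist_v' v_adjacent_iff)
  then have "v b = w"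
    using closer_neighbor_unique[of u "v b" w "v a"] W_adj w v_in_verts assms by blast
  then show False using W_off w \<open>b \<le> D\<close> by blast
qed

lemma dist_W:
  assumes "w \<in> W" "z \<in> pverts G" "z \<notin> B"
  shows "d w z = Suc (d u z)"
proof -
  have "d z u \<le> d z w" using assms by (force simp: B_def)
  then have "d z w = Suc (d z u)"
    using edge_dist_Suc[of w u z] W_adj assms arcs_symmetric by blast
  then show ?thesis using dist_commute assms W_subset by simp
qed

text \<open>A geodesic from \<open>x\<close> out of \<open>B\<close> must use the edge joining the
  root \<open>w\<close> of its branch to \<open>u\<close>.\<close>

lemma dist_B:
  assumes "x \<in> B" "z \<in> pverts G" "z \<notin> B"
  shows "d x z = d x u + d u z"
proof -
  obtain w where w: "w \<in> W" "d x w < d x u" and x: "x \<in> pverts G"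
    using assms(1) by (auto simp: B_def)
  have wu: "(w, u) \<in> parcs G" using W_adj w arcs_symmetric by blast
  have "d z u < d z w"
    using dist_W[OF w(1) assms(2,3)] dist_commute W_subset w assms(2) by simp
  then have "d x z = d x w + 1 + d u z"
    using dist_through_edge[OF wu x assms(2) w(2)] by simp
  moreover have "d x u = Suc (d x w)"
    using edge_dist_Suc[of u w x] W_adj w x by simp
  ultimately show ?thesis by simp
qed

section \<open>The graph after the move: connectedness and eccentricities\<close>

lemma parcs_G'_iff:
  "(x, y) \<in> parcs G' \<longleftrightarrow>
    (x, y) \<in> parcs G \<and> \<not> (x = u \<and> y \<in> W) \<and> \<not> (x \<in> W \<and> y = u) \<or>
    x = v 0 \<and> y \<in> W \<or> x \<in> W \<and> y = v 0"
  by (auto simp: move_edges_def)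

lemma pverts_G' [simp]: "pverts G' = pverts G"
  by (simp add: move_edges_def)

lemma pair_graph_G': "pair_graph G'"
proof -
  have wf: "x \<in> pverts G \<and> y \<in> pverts G \<and> x \<noteq> y" if "(x, y) \<in> parcs G'" for x y
    using that W_subset[of x] W_subset[of y] W_off[of 0] in_arcsD1[of x y] in_arcsD2[of x y]
      no_loops'[of x y] by (auto simp: parcs_G'_iff)
  have "parcs G' \<subseteq> pverts G \<times> pverts G" using wf by auto
  then have fin: "finite (parcs G')" using pair_finite_verts finite_subset by blast
  have "sym (parcs G')"
    by (rule symI) (auto simp: parcs_G'_iff intro: arcs_symmetric)
  then show ?thesis
    by unfold_locales (use wf fin pair_finite_verts in \<open>force simp: symmetric_def\<close>)+
qed

text \<open>Outside \<open>B\<close>, geodesics of \<open>G\<close> to \<open>v 0\<close> survive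
  the move. Inside \<open>B\<close>, geodesics towards \<open>u\<close> survive up to the vertex of
  \<open>W\<close> where they leave \<open>B\<close>, and this vertex is now adjacent to
  \<open>v 0\<close>.\<close>

lemma reachable_v_0:
  assumes "x \<in> pverts G"
  shows "(x, v 0) \<in> (parcs G')\<^sup>*"
proof -
  have nonB: "(x, v 0) \<in> (parcs G')\<^sup>*" if "x \<in> pverts G" "x \<notin> B" for x
    using that
  proof (induction "d x (v 0)" arbitrary: x)
    case 0
    then show ?case by (simp add: dist_eq_0_iff)
  next
    case (Suc n)
    obtain y where y: "(x, y) \<in> parcs G" "d y (v 0) = n"
      using dist_SucE[OF Suc.prems(1) v_0_in_verts Suc.hyps(2)[symmetric]] .
    \<comment> \<open>Entering \<open>B\<close> means stepping from \<open>u\<close> into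
      \<open>W\<close>, which increases the distance to \<open>v 0\<close>.\<close>
    have "y \<notin> B"
    proof
      assume "y \<in> B"
      then have "y \<in> W" "x = u"
        using B_boundary[of y x] y Suc.prems arcs_symmetric by blast+
      then show False using dist_W[of y "v 0"] v_not_in_B[of 0] y Suc.hyps(2) by simp
    qed
    moreover have "(x, y) \<in> parcs G'"
      using y Suc.prems \<open>y \<notin> B\<close> W_subset_B by (auto simp: parcs_G'_iff)
    ultimately show ?case
      using Suc.hyps(1)[of y] y in_arcsD2 by (meson converse_rtrancl_into_rtrancl)
  qed
  have "(x, v 0) \<in> (parcs G')\<^sup>*" if "x \<in> B" for x
    using that
  proof (induction "d x u" arbitrary: x)
    case 0
    then show ?case by (auto simp: B_def)
  next
    case (Suc n)
    then have "x \<in> pverts G" by (simp add: B_def)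
    then obtain y where y: "(x, y) \<in> parcs G" "d y u = n"
      using dist_SucE[OF _ u_in_verts Suc.hyps(2)[symmetric]] by blast
    show ?case
    proof (cases "y \<in> B")
      case True
      then have "(x, y) \<in> parcs G'"
        using y Suc.prems u_not_in_B by (auto simp: parcs_G'_iff)
      then show ?thesis
        using Suc.hyps(1)[of y] y True by (meson converse_rtrancl_into_rtrancl)
    next
      case False
      then have "x \<in> W" using B_boundary y Suc.prems by blast
      then show ?thesis by (auto simp: parcs_G'_iff)
    qed
  qed
  then show ?thesis using nonB assms by blast
qed

lemma connected_G': "connected_pair_graph G'"
proof -
  interpret G': pair_graph G' by (rule pair_graph_G')
  have "sym ((parcs G')\<^sup>*)"
    by (rule sym_rtrancl) (auto intro!: symI dest: G'.arcs_symmetric)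
  then have "(x, y) \<in> (parcs G')\<^sup>*" if "x \<in> pverts G" "y \<in> pverts G" for x y
    using reachable_v_0 that by (meson rtrancl_trans symE)
  then show ?thesis by unfold_locales simp
qed

text \<open>
  Distances in \<open>G'\<close> are bounded from below by 1-Lipschitz potentials: the distances in \<open>G\<close> to the
  two ends of the diametric path, corrected on the transplanted branches \<open>B\<close>.
\<close>
lemma eccentricity_mono:
  assumes x: "x \<in> pverts G"
  shows "eccentricity G x \<le> eccentricity G' x"
proof -
  interpret G': connected_pair_graph G' by (rule connected_G')
  \<comment> \<open>After the move a vertex \<open>x\<close> of \<open>B\<close> should reach
    \<open>v 0\<close> at distance \<open>d x u\<close> and \<open>v D\<close> at distance
    \<open>d x u + D\<close>. The latter exceeds \<open>d x (v D)\<close> by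
    \<open>j\<close>.\<close>
  define f where "f y = (if y \<in> B then d y (v D) + j else d y (v D))" for y
  define g where "g y = (if y \<in> B then d y u else d y (v 0))" for y
  have v0: "v 0 \<notin> B" and vD: "v D \<notin> B" using v_not_in_B by auto
  have du: "d u (v D) = D - j" "d u (v 0) = j" using dist_v' j_less by auto
  have same_side: "a \<in> B \<longleftrightarrow> b \<in> B"
    if "(a, b) \<in> parcs G" "\<not> (a = u \<and> b \<in> W)" "\<not> (a \<in> W \<and> b = u)" for a b
    using that B_boundary arcs_symmetric by blast
  have W: "f w = Suc D" "g w = 1" if "w \<in> W" for w
    using dist_W[OF that _ vD] dist_W[OF that _ u_not_in_B] du j_less W_subset_B[OF that]
    by (simp_all add: f_def g_def)
  have z: "f (v 0) = D" "g (v 0) = 0" using v0 dist_ends by (simp_all add: f_def g_def)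
  have fL: "f a \<le> Suc (f b)" and gL: "g a \<le> Suc (g b)" if e: "(a, b) \<in> parcs G'" for a b
  proof -
    consider "(a, b) \<in> parcs G" "\<not> (a = u \<and> b \<in> W)" "\<not> (a \<in> W \<and> b = u)" | "a = v 0" "b \<in> W"
      | "a \<in> W" "b = v 0"
      using e unfolding parcs_G'_iff by blast
    then have "f a \<le> Suc (f b) \<and> g a \<le> Suc (g b)"
    proof cases
      case 1
      then show ?thesis
        using same_side[OF 1] dist_adjacent_le[OF 1(1)] by (simp add: f_def g_def)
    qed (use W z in auto)
    then show "f a \<le> Suc (f b)" "g a \<le> Suc (g b)" by auto
  qed
  have "f x \<le> f (v D) + G'.d x (v D)" "g x \<le> g (v 0) + G'.d x (v 0)"
    using G'.lipschitz_le_dist fL gL x by simp_all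
  moreover have "f (v D) = 0" using vD by (simp add: f_def)
  ultimately have le: "f x \<le> G'.d x (v D)" "g x \<le> G'.d x (v 0)" using z by simp_all
  have ecc: "G'.d x (v D) \<le> eccentricity G' x" "G'.d x (v 0) \<le> eccentricity G' x"
    using G'.dist_le_eccentricity by simp_all
  \<comment> \<open>On \<open>B\<close>, the value \<open>f x = d x u + D\<close> dominates both
    \<open>d x u + j\<close> and \<open>d x u + (D - j)\<close>. Elsewhere the two maxima
    agree.\<close>
  have "max (d x (v 0)) (d x (v D)) \<le> max (f x) (g x)"
    using dist_B[of x "v 0"] dist_B[of x "v D"] v0 vD du j_less by (auto simp: f_def g_def)
  then show ?thesis using eccentricity_le_max[OF x] le ecc by linarith
qed

section \<open>Degrees and degree products before and after the move\<close>

abbreviation k :: nat where "k \<equiv> card W"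
abbreviation ecc :: "'a \<Rightarrow> nat" where "ecc \<equiv> eccentricity (with_proj G)"

text \<open>For a neighbor \<open>x\<close> of \<open>u\<close> other than \<open>v 0\<close> and
  \<open>v 1\<close>, the move affects only the factor contributed by \<open>u\<close>, or by
  \<open>v 0\<close> in its place; \<open>Q x\<close> collects the unchanged factors.\<close>

definition Q :: "'a \<Rightarrow> nat" where "Q x = (\<Prod>y\<in>N x - {u}. card (N y))"
text \<open>The factor of \<open>M(u)\<close> that is transferred to \<open>v 0\<close>.\<close>

definition MW :: nat where "MW = (\<Prod>w\<in>W. card (N w))"
definition MR :: nat where "MR = (\<Prod>y\<in>N u - W. card (N y))"

lemma k_pos: "0 < k"
  using W_ne by (simp add: card_gt_0_iff)

lemma two_le_D: "2 \<le> D"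
  using j_pos j_less by simp

lemma v_0_in_N_iff: "v 0 \<in> N x \<longleftrightarrow> x = v 1"
  using N_v_0 N_sym by auto

lemma v_in_N_v_iff: "a \<le> D \<Longrightarrow> b \<le> D \<Longrightarrow> v b \<in> N (v a) \<longleftrightarrow> b = Suc a \<or> a = Suc b"
  by (simp add: in_N_iff v_adjacent_iff)

lemma u_neq_v_0 [simp]: "u \<noteq> v 0" "v 0 \<noteq> u"
  using v_eq_iff[of j 0] j_pos j_less by auto

lemma v_1_neq_v_0 [simp]: "v (Suc 0) \<noteq> v 0" "v 0 \<noteq> v (Suc 0)"
  using v_eq_iff[of 1 0] D_pos by auto

lemma u_not_in_W [simp]: "u \<notin> W" and v_0_not_in_W [simp]: "v 0 \<notin> W"
  and v_1_not_in_W [simp]: "v (Suc 0) \<notin> W"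
  using W_off[of j] W_off[of 0] W_off[of 1] j_less by auto

lemma N'_u: "N' u = N u - W"
  by (auto simp: neighbors_def parcs_G'_iff)

lemma N'_v_0: "N' (v 0) = insert (v 1) W"
  using N_v_0 by (auto simp: neighbors_def parcs_G'_iff)

lemma N'_W: "w \<in> W \<Longrightarrow> N' w = insert (v 0) (N w - {u})"
  by (auto simp: neighbors_def parcs_G'_iff)

lemma N'_other: "x \<notin> W \<Longrightarrow> x \<noteq> u \<Longrightarrow> x \<noteq> v 0 \<Longrightarrow> N' x = N x"
  by (auto simp: neighbors_def parcs_G'_iff)

lemma card_N'_u: "card (N' u) = card (N u) - k"
  by (simp add: N'_u card_Diff_subset W_subset_N)

lemma card_N'_v_0: "card (N' (v 0)) = Suc k"
  by (simp add: N'_v_0)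

lemma card_N'_other:
  assumes "y \<noteq> u" "y \<noteq> v 0"
  shows "card (N' y) = card (N y)"
proof (cases "y \<in> W")
  case True
  then have "u \<in> N y" using W_subset_N N_sym by blast
  moreover have "v 0 \<notin> N y" using True v_0_in_N_iff W_off[of 1] two_le_D by auto
  ultimately show ?thesis
    using card_Suc_Diff1[of "N y" u] by (simp add: N'_W[OF True])
next
  case False
  then show ?thesis using N'_other assms by simp
qed

lemma Q_pos: "1 \<le> Q x"
  unfolding Q_def using card_N_ge_1 by (intro prod_ge_1) auto

lemma MW_pos: "1 \<le> MW"
  unfolding MW_def using card_N_ge_1 W_subset_N by (intro prod_ge_1) auto

lemma M_neighbor: "x \<in> N u \<Longrightarrow> M G x = card (N u) * Q x"
  unfolding M_eq_prod_card Q_def using N_sym[of x u] by (simp add: prod.remove)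

text \<open>The vertex \<open>v 1\<close> is excluded because its neighbor \<open>v 0\<close> gains
  degree, and \<open>v 0\<close> because its own neighborhood grows.\<close>

lemma M'_neighbor:
  assumes "x \<in> N u" "x \<notin> W" "x \<noteq> v 0" "x \<noteq> v 1"
  shows "M G' x = (card (N u) - k) * Q x"
proof -
  have "N' x = N x" using assms by (intro N'_other) auto
  moreover have "u \<in> N x" using assms N_sym by blast
  ultimately have "M G' x = card (N' u) * (\<Prod>y\<in>N x - {u}. card (N' y))"
    unfolding M_eq_prod_card by (simp add: prod.remove)
  also have "(\<Prod>y\<in>N x - {u}. card (N' y)) = Q x"
    unfolding Q_def using assms v_0_in_N_iff[of x] by (intro prod.cong refl card_N'_other) auto
  finally show ?thesis by (simp add: card_N'_u)
qed

text \<open>Around a moved vertex, \<open>u\<close> is exchanged for \<open>v 0\<close>, whose new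
  degree \<open>k + 1\<close> is smaller than the old degree of \<open>u\<close>.\<close>

lemma M'_W:
  assumes "x \<in> W"
  shows "M G' x = Suc k * Q x"
proof -
  have v0: "v 0 \<notin> N x" using assms v_0_in_N_iff W_off[of 1] two_le_D by auto
  then have "M G' x = card (N' (v 0)) * (\<Prod>y\<in>N x - {u}. card (N' y))"
    unfolding M_eq_prod_card by (simp add: N'_W[OF assms])
  also have "(\<Prod>y\<in>N x - {u}. card (N' y)) = Q x"
    unfolding Q_def using v0 by (intro prod.cong refl card_N'_other) auto
  finally show ?thesis by (simp add: card_N'_v_0)
qed

lemma M'_other:
  assumes "x \<notin> N u" "x \<noteq> u" "x \<noteq> v 0" "x \<noteq> v 1"
  shows "M G' x = M G x"
proof -
  have "N' x = N x" using assms W_subset_N by (intro N'_other) auto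
  then show ?thesis
    unfolding M_eq_prod_card using assms N_sym v_0_in_N_iff[of x]
    by (intro prod.cong card_N'_other) auto
qed

lemma M_u: "M G u = MW * MR"
  unfolding M_eq_prod_card MW_def MR_def using prod.subset_diff[OF W_subset_N] by (simp add: mult.commute)

lemma M'_u:
  assumes "2 \<le> j"
  shows "M G' u = MR"
proof -
  have "v 0 \<notin> N u" using assms v_in_N_v_iff[of j 0] j_less by simp
  then show ?thesis
    unfolding M_eq_prod_card N'_u MR_def by (intro prod.cong refl card_N'_other) auto
qed

lemma M_v_0: "M G (v 0) = card (N (v 1))"
  unfolding M_eq_prod_card by (simp add: N_v_0)

lemma M'_v_0: "M G' (v 0) = card (N' (v 1)) * MW"
proof -
  have "(\<Prod>w\<in>W. card (N' w)) = MW"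
    unfolding MW_def by (intro prod.cong refl card_N'_other) auto
  then show ?thesis unfolding M_eq_prod_card by (simp add: N'_v_0)
qed

lemma card_N_leaf: "y \<in> N (v 1) \<Longrightarrow> y \<noteq> v 2 \<Longrightarrow> card (N y) = 1"
  using N_v_1_leaf[of y] two_le_D by (simp add: in_N_iff)

lemma v_2_in_N_v_1: "v 2 \<in> N (v 1)" and v_0_in_N_v_1: "v 0 \<in> N (v 1)"
  and v_2_neq_v_0: "v 2 \<noteq> v 0"
  using v_in_N_v_iff[of 1 2] v_in_N_v_iff[of 1 0] v_eq_iff[of 2 0] two_le_D
  by (auto simp: numeral_2_eq_2)

lemma M_v_1: "M G (v 1) = card (N (v 2))"
proof -
  have "M G (v 1) = card (N (v 0)) * card (N (v 2))"
    unfolding M_eq_prod_card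
    by (rule prod_eq_two_factors)
      (use v_2_in_N_v_1 v_0_in_N_v_1 v_2_neq_v_0 card_N_leaf in auto)
  then show ?thesis by (simp add: N_v_0)
qed

text \<open>Apart from \<open>v 0\<close> and \<open>v 2\<close> all neighbors of \<open>v 1\<close>
  are leaves, also if \<open>v 1 = u\<close> loses \<open>W\<close>. The degree of
  \<open>v 2\<close> is taken in \<open>G'\<close> because \<open>v 2\<close> may be
  \<open>u\<close>.\<close>

lemma M'_v_1: "M G' (v 1) = Suc k * card (N' (v 2))"
proof -
  have sub: "N' (v 1) \<subseteq> N (v 1)" "v 0 \<in> N' (v 1)" "v 2 \<in> N' (v 1)"
    using v_2_in_N_v_1 v_0_in_N_v_1 W_off[of 2] two_le_D N'_u N'_other[of "v 1"] W_off[of 1]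
    by (cases "v 1 = u"; auto)+
  have "M G' (v 1) = card (N' (v 0)) * card (N' (v 2))"
    unfolding M_eq_prod_card
  proof (rule prod_eq_two_factors)
    fix y assume y: "y \<in> N' (v 1)" "y \<noteq> v 0" "y \<noteq> v 2"
    then have "y \<in> N (v 1)" using sub by blast
    moreover from this have "y \<noteq> u" using v_in_N_v_iff[of 1 j] j_less j_pos y two_le_D
      by (auto simp: numeral_2_eq_2)
    ultimately show "card (N' y) = 1" using card_N'_other[of y] card_N_leaf[of y] y by simp
  qed (use sub v_2_neq_v_0 finite_subset[OF sub(1)] in auto)
  then show ?thesis by (simp add: card_N'_v_0)
qed

lemma M'_le:
  assumes "x \<noteq> v 0" "x \<noteq> v 1"
  shows "M G' x \<le> M G x"
proof -
  consider "x = u" | "x \<in> W" | "x \<in> N u" "x \<notin> W" | "x \<noteq> u" "x \<notin> N u" by blast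
  then show ?thesis
  proof cases
    case 1
    then have "2 \<le> j" using assms j_pos by (cases "j = 1") auto
    then show ?thesis using 1 M_u M'_u MW_pos by simp
  next
    case 2
    then have "x \<in> N u" using W_subset_N by blast
    then show ?thesis using M'_W[OF 2] M_neighbor card_W by (simp del: mult_Suc)
  next
    case 3
    then show ?thesis using M'_neighbor M_neighbor assms by simp
  next
    case 4
    then show ?thesis using M'_other assms by simp
  qed
qed

text \<open>
  A lower bound for the contribution of \<open>x\<close> to \<open>\<xi>\<^sup>a\<^sup>c(G) - \<xi>\<^sup>a\<^sup>c(G')\<close>: the eccentricity of \<open>x\<close> in
  \<open>G'\<close> is replaced by the one in \<open>G\<close>.
\<close>
definition \<delta> :: "'a \<Rightarrow> real" where
  "\<delta> x = (real (M G x) - real (M G' x)) / real (ecc x)"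

lemma xi_ac_diff_ge: "(\<Sum>x\<in>pverts G. \<delta> x) \<le> xi_ac G - xi_ac G'"
proof -
  have "\<delta> x \<le> real (M G x) / real (ecc x) - real (M G' x) / real (eccentricity G' x)"
    if "x \<in> pverts G" for x
  proof -
    have "real (M G' x) / real (eccentricity G' x) \<le> real (M G' x) / real (ecc x)"
      using eccentricity_mono[OF that] eccentricity_pos[OF that] by (intro divide_left_mono) auto
    then show ?thesis by (simp add: \<delta>_def diff_divide_distrib)
  qed
  then have "(\<Sum>x\<in>pverts G. \<delta> x)
    \<le> (\<Sum>x\<in>pverts G. real (M G x) / real (ecc x) - real (M G' x) / real (eccentricity G' x))"
    by (rule sum_mono)
  then show ?thesis by (simp add: xi_ac_def sum_subtractf)
qed

text \<open>Only \<open>v 0\<close> and \<open>v 1\<close> can contribute negatively, so it suffices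
  to exhibit enough losses on some set containing both.\<close>

lemma xi_ac_less:
  assumes "S \<subseteq> pverts G" "v 0 \<in> S" "v 1 \<in> S" "0 < sum \<delta> S"
  shows "xi_ac G' < xi_ac G"
proof -
  have "sum \<delta> S \<le> sum \<delta> (pverts G)"
  proof (rule sum_mono2)
    fix x assume "x \<in> pverts G - S"
    then have "M G' x \<le> M G x" using assms(2,3) by (intro M'_le) auto
    then show "0 \<le> \<delta> x" by (simp add: \<delta>_def)
  qed (use assms(1) pair_finite_verts in auto)
  then show ?thesis using xi_ac_diff_ge assms(4) by linarith
qed

section \<open>Lower bounds for the weighted losses\<close>

lemma \<delta>_ge:
  assumes "x \<in> pverts G" "M G' x + c \<le> M G x" "ecc x \<le> e"
  shows "real c / real e \<le> \<delta> x"
  unfolding \<delta>_def using assms eccentricity_pos[OF assms(1)] by (intro frac_le) auto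

lemma ecc_v_0: "ecc (v 0) = D"
  using eccentricity_v_le[of 0] le_eccentricity_v[of 0] by simp

lemma ecc_v_1: "ecc (v 1) = D - 1"
  using eccentricity_v_le[of 1] le_eccentricity_v[of 1] two_le_D by simp

text \<open>The factor \<open>deg u\<close> of \<open>M(w)\<close> drops to \<open>k + 1\<close>,
  while the cofactor \<open>Q w\<close> is at least 1 and the eccentricity at most
  \<open>D\<close>.\<close>

lemma \<delta>_W_ge:
  assumes "w \<in> W"
  shows "real (card (N u) - k - 1) / real D \<le> \<delta> w"
proof (rule \<delta>_ge)
  have "Suc k * Q w + (card (N u) - k - 1) * Q w = card (N u) * Q w"
    using card_W by (subst add_mult_distrib[symmetric]) simp
  moreover have "card (N u) - k - 1 \<le> (card (N u) - k - 1) * Q w" using Q_pos[of w] by simp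
  ultimately show "M G' w + (card (N u) - k - 1) \<le> M G w"
    using M'_W[OF assms] M_neighbor[OF subsetD[OF W_subset_N assms]] by linarith
qed (use assms W_subset eccentricity_le_D in auto)

lemma \<delta>_neighbor_ge:
  assumes "x \<in> N u" "x \<notin> W" "x \<noteq> v 0" "x \<noteq> v 1" "ecc x \<le> e"
  shows "real (k * Q x) / real e \<le> \<delta> x"
proof (rule \<delta>_ge)
  have "(card (N u) - k) * Q x + k * Q x = card (N u) * Q x"
    using card_W by (simp flip: add_mult_distrib)
  then show "M G' x + k * Q x \<le> M G x"
    using M'_neighbor[OF assms(1-4)] M_neighbor[OF assms(1)] by simp
qed (use assms N_in_verts in auto)

text \<open>All factors of \<open>MR\<close> are at least 1, so each one bounds it from below. It
  will be applied to the path neighbor \<open>v (j - 1)\<close>.\<close>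

lemma MR_ge:
  assumes "y \<in> N u" "y \<notin> W"
  shows "card (N y) \<le> MR"
proof -
  have "1 \<le> (\<Prod>z\<in>N u - W - {y}. card (N z))" using card_N_ge_1 by (intro prod_ge_1) auto
  then show ?thesis unfolding MR_def using assms by (simp add: prod.remove[of "N u - W" y])
qed

lemma Q_ge:
  assumes "y \<in> N x" "y \<noteq> u"
  shows "card (N y) \<le> Q x"
proof -
  have "1 \<le> (\<Prod>z\<in>N x - {u} - {y}. card (N z))" using card_N_ge_1 by (intro prod_ge_1) auto
  then show ?thesis unfolding Q_def using assms by (simp add: prod.remove[of "N x - {u}" y])
qed

text \<open>The product at \<open>v 0\<close> grows by \<open>deg (v 1) * (MW - 1)\<close> at
  eccentricity \<open>D\<close>, while that at \<open>u\<close> drops by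
  \<open>MR * (MW - 1)\<close> at eccentricity at most \<open>D\<close>.\<close>

lemma \<delta>_v_0_u:
  assumes "2 \<le> j" "card (N (v 1)) \<le> MR"
  shows "0 \<le> \<delta> (v 0) + \<delta> u"
proof -
  have "v 1 \<noteq> u" using v_eq_iff[of 1 j] assms j_less by auto
  then have "M G' (v 0) = card (N (v 1)) * MW" using M'_v_0 card_N'_other[of "v 1"] by simp
  then have "\<delta> (v 0) = - (real (card (N (v 1)) * (MW - 1)) / real D)"
    using MW_pos
    by (simp add: \<delta>_def M_v_0 ecc_v_0 of_nat_diff right_diff_distrib diff_divide_distrib)
  moreover have "real (card (N (v 1)) * (MW - 1)) / real D \<le> \<delta> u"
  proof (rule \<delta>_ge)
    have "MR + card (N (v 1)) * (MW - 1) \<le> MR + MR * (MW - 1)" using assms by simp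
    also have "\<dots> = MW * MR" using MW_pos by (cases MW) auto
    finally show "M G' u + card (N (v 1)) * (MW - 1) \<le> M G u" using M_u M'_u assms by simp
  qed (use eccentricity_le_D in auto)
  ultimately show ?thesis by simp
qed

text \<open>The loss at \<open>v\<^sub>j\<^sub>-\<^sub>1\<close> compensates the growth at \<open>v\<^sub>1\<close>, and the vertices of \<open>W\<close> make it strict.\<close>
lemma xi_ac_less_if_j_ge_3:
  assumes j: "3 \<le> j" and deg: "card (N (v 1)) \<le> 2" "card (N (v 2)) \<le> 2"
  shows "xi_ac G' < xi_ac G"
proof -
  let ?t = "v (j - 1)"
  have t: "?t \<in> N u" "?t \<notin> W" "?t \<noteq> v 0" "?t \<noteq> v 1" "?t \<noteq> u"
    using v_in_N_v_iff[of j "j - 1"] W_off[of "j - 1"] v_eq_iff[of "j - 1"] j j_less by auto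
  have "2 \<le> card (N ?t)" using two_le_card_N_v j j_less by simp
  \<comment> \<open>\<open>MR\<close> is at least the degree of the inner path vertex
    \<open>v (j - 1)\<close>, hence at least 2, which bounds the degree of
    \<open>v 1\<close>.\<close>
  then have pair: "0 \<le> \<delta> (v 0) + \<delta> u" using \<delta>_v_0_u MR_ge[of ?t] t deg j by simp
  have "v 2 \<noteq> u" "v 2 \<noteq> v 0" using v_eq_iff[of 2] j j_less by auto
  then have "M G' (v 1) = Suc k * card (N (v 2))" using M'_v_1 card_N'_other by simp
  then have v1: "\<delta> (v 1) = - (real (k * card (N (v 2))) / real (D - 1))"
    unfolding \<delta>_def M_v_1 ecc_v_1 by (simp add: algebra_simps flip: minus_divide_left)
  have "v (j - 2) \<in> N ?t" "v (j - 2) \<noteq> u"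
    using v_in_N_v_iff[of "j - 1" "j - 2"] v_eq_iff[of "j - 2"] j j_less by auto
  \<comment> \<open>Since \<open>3 \<le> j\<close>, the vertex \<open>v (j - 2)\<close> is an inner
    path vertex and contributes a factor of at least 2 to \<open>Q ?t\<close>.\<close>
  then have "card (N (v 2)) \<le> Q ?t"
    using Q_ge[of "v (j - 2)" ?t] two_le_card_N_v[of "j - 2"] deg j j_less by linarith
  moreover have "ecc ?t \<le> D - 1" using eccentricity_v_le[of "j - 1"] j j_less by simp linarith
  ultimately have "real (k * card (N (v 2))) / real (D - 1) \<le> real (k * Q ?t) / real (D - 1)"
    "real (k * Q ?t) / real (D - 1) \<le> \<delta> ?t"
    using \<delta>_neighbor_ge t by (auto intro!: divide_right_mono mult_left_mono)
  then have "0 \<le> \<delta> (v 1) + \<delta> ?t" using v1 by simp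
  moreover have "0 < sum \<delta> W"
  proof (rule sum_pos)
    fix w assume "w \<in> W"
    moreover have "0 < real (card (N u) - k - 1) / real D" using card_W D_pos by simp
    ultimately show "0 < \<delta> w" using \<delta>_W_ge less_le_trans by blast
  qed (use W_ne in auto)
  moreover have "v 1 \<noteq> u" using v_eq_iff[of 1 j] j j_less by auto
  then have "sum \<delta> (insert (v 0) (insert (v 1) (insert ?t (insert u W))))
    = \<delta> (v 0) + (\<delta> (v 1) + (\<delta> ?t + (\<delta> u + sum \<delta> W)))"
    using t by (subst sum.insert; auto)+
  ultimately have "0 < sum \<delta> (insert (v 0) (insert (v 1) (insert ?t (insert u W))))"
    using pair by linarith
  then show ?thesis
    by (rule xi_ac_less[rotated 3]) (use W_subset v_in_verts[of 1] t N_in_verts D_pos in auto)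
qed

text \<open>
  With \<open>m = deg u - k - 1\<close>, the growth at \<open>v\<^sub>1\<close> is \<open>km/(D - 1)\<close>, while \<open>W\<close> and the \<open>m\<close> remaining
  neighbors of \<open>u\<close> lose at least \<open>km/D\<close> each.
\<close>
lemma xi_ac_less_if_j_eq_2:
  assumes j: "j = 2"
  shows "xi_ac G' < xi_ac G"
proof -
  let ?R = "N u - W - {v 1}"
  define m where "m = card (N u) - k - 1"
  have m: "card (N u) = k + m + 1" "0 < m" using card_W by (auto simp: m_def)
  have D: "3 \<le> D" using j j_less by simp
  have v1: "v 1 \<in> N u" "v 1 \<noteq> u" "v 0 \<notin> N u"
    using v_in_N_v_iff[of j] v_eq_iff[of 1 j] j j_less by auto
  \<comment> \<open>For \<open>j = 2\<close> the vertex \<open>v 1\<close> is itself a remaining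
    neighbor of \<open>u\<close>, so \<open>MR\<close> bounds its degree directly.\<close>
  have pair: "0 \<le> \<delta> (v 0) + \<delta> u" using \<delta>_v_0_u MR_ge[of "v 1"] v1 j by simp
  have cardR: "card ?R = m"
    using v1 by (simp add: card_Diff_subset W_subset_N m(1))
  have "card (N (v 2)) = k + m + 1" "card (N' (v 2)) = m + 1"
    using j m card_N'_u by simp_all
  then have "M G (v 1) = k + m + 1" "M G' (v 1) = Suc k * (m + 1)" using M_v_1 M'_v_1 by simp_all
  \<comment> \<open>The difference \<open>(k + m + 1) - (k + 1) * (m + 1)\<close> equals
    \<open>- k * m\<close>.\<close>
  then have d1: "\<delta> (v 1) = - (real (k * m) / real (D - 1))"
    unfolding \<delta>_def ecc_v_1 by (simp add: algebra_simps flip: minus_divide_left)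
  define X where "X = real k * (real m / real D)"
  have "X \<le> sum \<delta> W"
    using sum_bounded_below[of W "real m / real D" \<delta>] \<delta>_W_ge by (simp add: m_def X_def)
  moreover have "X \<le> sum \<delta> ?R"
  proof -
    have "real k / real D \<le> \<delta> x" if x: "x \<in> ?R" for x
    proof -
      have "x \<noteq> v 0" using x v1 by auto
      then have "real (k * Q x) / real D \<le> \<delta> x"
        using \<delta>_neighbor_ge x eccentricity_le_D N_in_verts by auto
      moreover have "real k / real D \<le> real (k * Q x) / real D"
        using Q_pos[of x] by (intro divide_right_mono) (auto simp del: of_nat_mult)
      ultimately show ?thesis by linarith
    qed
    then show ?thesis using sum_bounded_below[of ?R "real k / real D" \<delta>] cardR
      by (simp add: X_def mult.commute)
  qed
  moreover have "- 2 * X < \<delta> (v 1)"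
  proof -
    \<comment> \<open>Strictness of the whole estimate comes from here; the inequality amounts to
      \<open>D > 2\<close>.\<close>
    have "1 / real (D - 1) < 2 / real D" using D by (simp add: field_simps)
    then have "real (k * m) * (1 / real (D - 1)) < real (k * m) * (2 / real D)"
      using k_pos m by (intro mult_strict_left_mono) auto
    then show ?thesis unfolding d1 X_def by (simp add: mult_ac)
  qed
  moreover have "sum \<delta> (insert (v 0) (insert (v 1) (insert u (W \<union> ?R))))
    = \<delta> (v 0) + (\<delta> (v 1) + (\<delta> u + (sum \<delta> W + sum \<delta> ?R)))"
    using v1 by (subst sum.insert sum.union_disjoint; auto)+
  ultimately have "0 < sum \<delta> (insert (v 0) (insert (v 1) (insert u (W \<union> ?R))))"
    using pair by linarith
  then show ?thesis
    by (rule xi_ac_less[rotated 3]) (use W_subset v1 N_in_verts in auto)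
qed

text \<open>The vertices of \<open>W\<close> are leaves and bring no factor to \<open>v 0\<close>,
  whose old neighbor \<open>v 1 = u\<close> loses \<open>k\<close> in degree.\<close>

lemma M'_v_0_if_j_eq_1:
  assumes j: "j = 1"
  shows "M G' (v 0) + k = M G (v 0)"
proof -
  have "MW = 1"
    unfolding MW_def using card_N_leaf W_off[of 2] two_le_D W_subset_N j
    by (intro prod.neutral) fastforce
  then show ?thesis using M_v_0 M'_v_0 card_N'_u card_W j by simp
qed

text \<open>The tree is a star with center \<open>v 1 = u\<close>. With
  \<open>m = deg u - k - 1\<close>, the center contributes \<open>- k\<close> at eccentricity 1,
  while \<open>v 0\<close> contributes at least \<open>k / 2\<close>, and \<open>W\<close> and the
  other leaves at least \<open>k * m / 2\<close> each. As \<open>m\<close> is at least 1, the total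
  is positive.\<close>

lemma xi_ac_less_star:
  assumes D: "D = 2"
  shows "xi_ac G' < xi_ac G"
proof -
  have j: "j = 1" using j_pos j_less D by simp
  let ?R = "N u - W - {v 0}"
  define m where "m = card (N u) - k - 1"
  have m: "card (N u) = k + m + 1" "0 < m" using card_W by (auto simp: m_def)
  have v0: "v 0 \<in> N u" using v_0_in_N_iff j by simp
  have cardR: "card ?R = m"
    using v0 by (simp add: card_Diff_subset W_subset_N m(1))
  have "card (N (v 2)) = 1" using N_v_D D by simp
  moreover have "card (N' (v 2)) = 1"
    using calculation card_N'_other[of "v 2"] v_eq_iff[of 2] j D by simp
  ultimately have "M G (v 1) = 1" "M G' (v 1) = Suc k" using M_v_1 M'_v_1 by simp_all
  then have d1: "\<delta> (v 1) = - real k"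
    unfolding \<delta>_def ecc_v_1 using D by simp
  have d0: "real k / 2 \<le> \<delta> (v 0)"
    using \<delta>_ge[of "v 0" k 2] M'_v_0_if_j_eq_1[OF j] ecc_v_0 D by simp
  define X where "X = real k * real m / 2"
  have W: "X \<le> sum \<delta> W"
    using sum_bounded_below[of W "real m / 2" \<delta>] \<delta>_W_ge D by (simp add: m_def X_def)
  have R: "X \<le> sum \<delta> ?R"
  proof -
    have "real k / 2 \<le> \<delta> x" if x: "x \<in> ?R" for x
    proof -
      have "x \<noteq> v 1" using x j by auto
      then have "real (k * Q x) / real D \<le> \<delta> x"
        using \<delta>_neighbor_ge x eccentricity_le_D N_in_verts by auto
      moreover have "real k / real D \<le> real (k * Q x) / real D"
        using Q_pos[of x] by (intro divide_right_mono) (auto simp del: of_nat_mult)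
      ultimately show ?thesis using D by simp
    qed
    then show ?thesis using sum_bounded_below[of ?R "real k / 2" \<delta>] cardR
      by (simp add: X_def mult.commute)
  qed
  have "real k \<le> 2 * X" using m(2) by (cases m) (simp_all add: X_def distrib_left)
  moreover have "sum \<delta> (insert (v 0) (insert (v 1) (W \<union> ?R)))
    = \<delta> (v 0) + (\<delta> (v 1) + (sum \<delta> W + sum \<delta> ?R))"
    using j by (subst sum.insert sum.union_disjoint; auto)+
  moreover have "0 < real k" using k_pos by simp
  ultimately have "0 < sum \<delta> (insert (v 0) (insert (v 1) (W \<union> ?R)))"
    using d0 d1 W R by linarith
  then show ?thesis
    by (rule xi_ac_less[rotated 3]) (use W_subset j u_in_verts N_in_verts in auto)
qed

text \<open>Since \<open>v\<^sub>2\<close> has smaller eccentricity than \<open>v\<^sub>1\<close>, its loss alone outweighs the growth at \<open>v\<^sub>1\<close>.\<close>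
lemma xi_ac_less_if_j_eq_1:
  assumes j: "j = 1" and D: "4 \<le> D" and deg: "card (N (v 2)) \<le> 2"
  shows "xi_ac G' < xi_ac G"
proof -
  have v2: "v 2 \<in> N u" "v 2 \<notin> W" "v 2 \<noteq> v 0" "v 2 \<noteq> v 1" "v 2 \<noteq> u"
    using v_in_N_v_iff[of j 2] W_off[of 2] v_eq_iff[of 2] j D by (auto simp: numeral_2_eq_2)
  have v0: "0 \<le> \<delta> (v 0)"
    using \<delta>_ge[of "v 0" k D] M'_v_0_if_j_eq_1[OF j] ecc_v_0
    by (simp add: order_trans[rotated])
  have "M G' (v 1) = Suc k * card (N (v 2))" using M'_v_1 card_N'_other v2 by simp
  then have v1: "\<delta> (v 1) = - (real (k * card (N (v 2))) / real (D - 1))"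
    unfolding \<delta>_def M_v_1 ecc_v_1 by (simp add: algebra_simps flip: minus_divide_left)
  define Y where "Y = real (k * card (N (v 2))) / real (D - 2)"
  have "v 3 \<in> N (v 2)" "v 3 \<noteq> u"
    using v_in_N_v_iff[of 2 3] v_eq_iff[of 3] j D by auto
  \<comment> \<open>As \<open>4 \<le> D\<close>, \<open>v 3\<close> is an inner path vertex, so its
    degree is at least 2 and hence at least that of \<open>v 2\<close>.\<close>
  then have "card (N (v 2)) \<le> Q (v 2)"
    using Q_ge[of "v 3" "v 2"] two_le_card_N_v[of 3] deg D by simp
  then have "Y \<le> real (k * Q (v 2)) / real (D - 2)"
    unfolding Y_def by (auto intro!: divide_right_mono mult_left_mono)
  \<comment> \<open>The bound is \<open>max 2 (D - 2)\<close>, and \<open>4 \<le> D\<close> makes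
    the second entry the maximum.\<close>
  moreover have "ecc (v 2) \<le> D - 2" using eccentricity_v_le[of 2] D by auto
  then have "real (k * Q (v 2)) / real (D - 2) \<le> \<delta> (v 2)" by (intro \<delta>_neighbor_ge v2)
  ultimately have "Y \<le> \<delta> (v 2)" by (rule order_trans)
  moreover have "- Y < \<delta> (v 1)"
    unfolding Y_def v1 neg_less_iff_less
    using k_pos D two_le_card_N_v[of 2] by (intro divide_strict_left_mono) auto
  moreover have "sum \<delta> {v 0, v 1, v 2} = \<delta> (v 0) + (\<delta> (v 1) + \<delta> (v 2))"
    using v2 by simp
  ultimately have "0 < sum \<delta> {v 0, v 1, v 2}" using v0 by linarith
  then show ?thesis
    by (rule xi_ac_less[rotated 3]) (use v_in_verts[of 1] v_in_verts[of 2] D in auto)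
qed

end

section \<open>Diametric paths and branching vertices\<close>

lemma undirected_tree_imp_tree_graph:
  assumes "undirected_tree T"
  shows "tree_graph T"
proof -
  have "pair_graph T" using assms by (simp add: undirected_tree_def)
  then interpret pair_graph T .
  have "strongly_connected T"
    using assms symmetric_connected_imp_strongly_connected pair_sym_arcs
    by (simp add: undirected_tree_def)
  then have "(x, y) \<in> (parcs T)\<^sup>*" if "x \<in> pverts T" "y \<in> pverts T" for x y
    using that reachable_rtranclI[of "with_proj T" x y] by (auto simp: strongly_connected_def)
  then show ?thesis
    using assms by unfold_locales (auto simp: undirected_tree_def)
qed

lemma vwalk_nth_adjacent:
  assumes "vwalk p H" "Suc a < length p"
  shows "(p ! a, p ! Suc a) \<in> arcs_ends H"
  using assms
proof (induction p arbitrary: a rule: vwalk_induct)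
  case (Cons x y es)
  then show ?case by (cases a) auto
qed simp

text \<open>Its contrapositive provides a branching vertex on every diametric path. Without one, the
  path contains all neighbors of its vertices and hence, by connectedness, all vertices; the
  isomorphism sends a vertex to its index.\<close>

lemma (in tree_diametric) digraph_iso_path_graph:
  assumes deg: "\<And>a. a \<le> D \<Longrightarrow> card (N (v a)) \<le> 2"
  shows "digraph_iso G (path_graph (card (pverts G)))"
proof -
  have closed: "N (v a) \<subseteq> v ` {..D}" if a: "a \<le> D" for a
  proof -
    consider "a = 0" | "a = D" | "0 < a" "a < D" using a by linarith
    then show ?thesis
    proof cases
      case 3
      have "{v (a - 1), v (Suc a)} \<subseteq> N (v a)" using 3 by (auto simp: in_N_iff v_adjacent_iff)
      moreover have "card {v (a - 1), v (Suc a)} = 2" using 3 by (simp add: v_eq_iff)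
      ultimately have "N (v a) = {v (a - 1), v (Suc a)}"
        using deg[OF a] by (intro card_seteq[symmetric]) auto
      then show ?thesis using 3 by auto
    qed (use N_v_0 N_v_D D_pos in auto)
  qed
  have "x \<in> v ` {..D}" if "x \<in> pverts G" for x
  proof -
    have "(v 0, x) \<in> (parcs G)\<^sup>*" using reachable_arcs v_in_verts that by simp
    then show ?thesis
    proof induction
      case (step y z)
      then obtain a where "a \<le> D" "z \<in> N (v a)" by (auto simp: in_N_iff)
      then show ?case using closed by blast
    qed auto
  qed
  then have V: "pverts G = v ` {..D}" using v_in_verts by auto
  have inj: "inj_on v {..D}" by (auto simp: inj_on_def v_eq_iff)
  then have card: "card (pverts G) = Suc D" by (simp add: V card_image)
  define f where "f = inv_into {..D} v"
  have f: "f (v a) = a" if "a \<le> D" for a using that inj by (simp add: f_def inv_into_f_f)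
  have injf: "inj_on f (pverts G)" unfolding f_def V by (rule inj_on_inv_into) simp
  define h where "h = \<lparr>iso_verts = f, iso_arcs = map_prod f f, iso_head = snd, iso_tail = fst\<rparr>"
  have sub: "parcs G \<subseteq> pverts G \<times> pverts G" using in_arcsD1 in_arcsD2 by auto
  have "digraph_isomorphism h"
    unfolding digraph_isomorphism_def h_def
    using injf inj_on_subset[OF map_prod_inj_on[OF injf injf] sub] wf_digraph_axioms by auto
  moreover have "with_proj (path_graph (card (pverts G))) = app_iso h G"
  proof (rule pre_digraph.equality)
    show "verts (with_proj (path_graph (card (pverts G)))) = verts (app_iso h G)"
      unfolding app_iso_simps with_proj_simps path_graph_def card h_def
      by (auto simp: V f image_image less_Suc_eq_le image_iff)
    show "arcs (with_proj (path_graph (card (pverts G)))) = arcs (app_iso h G)"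
    proof (rule set_eqI, rule iffI)
      fix e assume "e \<in> arcs (with_proj (path_graph (card (pverts G))))"
      then obtain a b where e: "e = (a, b)" "a \<le> D" "b \<le> D" "b = Suc a \<or> a = Suc b"
        by (auto simp: path_graph_def card less_Suc_eq_le)
      then have "(v a, v b) \<in> parcs G" by (simp add: v_adjacent_iff)
      then have "map_prod f f (v a, v b) \<in> map_prod f f ` parcs G" by (rule imageI)
      then show "e \<in> arcs (app_iso h G)" using e f by (simp add: h_def)
    next
      fix e assume "e \<in> arcs (app_iso h G)"
      then obtain x y where xy: "e = (f x, f y)" "(x, y) \<in> parcs G" by (auto simp: h_def)
      then obtain a b where "x = v a" "y = v b" "a \<le> D" "b \<le> D" using sub V by blast
      then show "e \<in> arcs (with_proj (path_graph (card (pverts G))))"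
        using xy f v_adjacent_iff by (auto simp: path_graph_def card less_Suc_eq_le)
    qed
  qed (simp_all add: h_def)
  ultimately show ?thesis unfolding digraph_iso_def by blast
qed

text \<open>Makes the reversed path a competitor in the maximal choice of \<open>P\<close>.\<close>

lemma (in tree_graph) diametric_path_rev:
  assumes "diametric_path G p"
  shows "diametric_path G (rev p)"
proof -
  have p: "vwalk p G" "distinct p" using assms by (auto simp: diametric_path_def vpath_def)
  then have ne: "p \<noteq> []" by auto
  have "vwalk (rev p) G"
    using p arcs_symmetric by (auto simp: vwalk_def set_vwalk_arcs_rev)
  moreover have "hd p \<in> pverts G" "last p \<in> pverts G"
    using p ne by (auto simp: vwalk_def)
  ultimately show ?thesis
    using assms p ne dist_commute[of "hd p" "last p"]
    by (simp add: diametric_path_def vpath_def hd_rev last_rev)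
qed

theorem theorem2:
  fixes T T' :: "'a pair_pre_digraph" and P :: "'a vwalk" and W :: "'a set" and u :: 'a
    and n D i k :: nat
  assumes tree: "undirected_tree T"
    and n: "card (pverts T) = n"
    and not_path: "\<not> digraph_iso T (path_graph n)"
    and D: "graph_diameter T = D"
    and P: "diametric_path T P"
    and P_farthest: "\<forall>Q. diametric_path T Q \<longrightarrow> first_branching T Q \<le> first_branching T P"
    and i: "i = first_branching T P"
    and u: "u = (if D > 2 \<and> i = 1 \<and> degree T (P ! 2) > 2 then P ! 2 else P ! i)"
    and W: "W \<subseteq> neighbors T u - set P" "card W = k"
    and k: "1 \<le> k" "k \<le> degree T u - 2"
    and T': "T' = move_edges T u (P ! 0) W"
  shows "xi_ac T > xi_ac T'"
proof -
  interpret T: tree_graph T using tree by (rule undirected_tree_imp_tree_graph)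
  have W_ne: "W \<noteq> {}" using W k by auto
  then obtain w where w: "(u, w) \<in> parcs T" using W(1) by (auto simp flip: T.in_N_iff)
  have D_pos: "0 < D"
    using T.dist_adjacent[OF w] T.dist_le_diameter[of u w] T.in_arcsD1[OF w] T.in_arcsD2[OF w] D
    by simp
  have walk: "vwalk P T" using P by (auto simp: diametric_path_def vpath_def)
  then have ne: "P \<noteq> []" by auto
  have "length P - 1 = D" using P D by (simp add: diametric_path_def)
  then have len: "length P = Suc D" using ne by (cases P) auto
  have ends: "hd P = P ! 0" "last P = P ! D" using ne len by (auto simp: hd_conv_nth last_conv_nth)
  interpret T: tree_diametric T "(!) P" D
  proof unfold_locales
    fix a assume "a < D"
    then show "(P ! a, P ! Suc a) \<in> parcs T" using vwalk_nth_adjacent[OF walk, of a] len by simp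
  next
    show "T.d (P ! 0) (P ! D) = D" using P D ends by (simp add: diametric_path_def)
  qed (use D_pos D T.dist_le_diameter in auto)
  have deg: "degree T x = card (T.N x)" for x by (rule degree_eq_card_neighbors)
  have "\<exists>a. a < length P \<and> branching T (P ! a)"
  proof (rule ccontr)
    assume "\<not> ?thesis"
    then have "\<not> branching T (P ! a)" if "a \<le> D" for a using that len by simp
    then have "card (T.N (P ! a)) \<le> 2" if "a \<le> D" for a
      using that by (fastforce simp: branching_def deg)
    then show False using T.digraph_iso_path_graph not_path n by simp
  qed
  then have "i < length P \<and> branching T (P ! i)"
    unfolding i first_branching_def by (rule LeastI_ex)
  then have i_le: "i \<le> D" and bi: "3 \<le> card (T.N (P ! i))"
    using len by (auto simp: branching_def deg)
  have before: "card (T.N (P ! a)) \<le> 2" if "a < i" for a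
    using not_less_Least[of a "\<lambda>i. i < length P \<and> branching T (P ! i)"] that i_le len
    unfolding i first_branching_def by (auto simp: branching_def deg)
  \<comment> \<open>The ends of a diametric path are leaves and therefore not branching.\<close>
  have i_bounds: "0 < i" "i < D"
    using bi T.N_v_0 T.N_v_D i_le by (cases "i = 0"; cases "i = D"; auto)+
  define j where "j = (if D > 2 \<and> i = 1 \<and> degree T (P ! 2) > 2 then 2 else i)"
  have uj: "u = P ! j" using u by (simp add: j_def)
  interpret T: edge_move T "(!) P" D j W
  proof unfold_locales
    show "0 < j" "j < D" using i_bounds by (auto simp: j_def)
  next
    fix a assume "a \<le> D"
    then show "P ! a \<notin> W" using W(1) len by auto
  next
    \<comment> \<open>Since \<open>1 \<le> k\<close>, the subtraction in
      \<open>k \<le> degree T u - 2\<close> is not truncated.\<close>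
    show "card W + 2 \<le> card (T.N (P ! j))" using k W(2) uj deg by simp
  qed (use W(1) W_ne uj in \<open>auto simp: T.in_N_iff\<close>)
  have T'_eq: "T' = T.G'" using T' uj by simp
  \<comment> \<open>The case \<open>j = 2\<close> unites \<open>i = 2\<close> with
    \<open>i = 1\<close> and branching \<open>v 2\<close>. For \<open>j = 1\<close> the diameter
    separates the star from the case where \<open>v 2\<close> has degree at most 2.\<close>
  consider "3 \<le> j" "j = i" | "j = 2" | "j = 1" "D = 2"
    | "j = 1" "i = 1" "D > 2" "card (T.N (P ! 2)) \<le> 2"
  proof -
    consider "3 \<le> i" | "i = 2" | "i = 1" "D = 2" | "i = 1" "D > 2" using i_bounds by linarith
    then show thesis
      using that unfolding j_def deg by cases (cases "2 < card (T.N (P ! 2))"; simp)+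
  qed
  then show ?thesis
  proof cases
    case 1
    then show ?thesis using T.xi_ac_less_if_j_ge_3 before[of 1] before[of 2] T'_eq by simp
  next
    case 2
    then show ?thesis using T.xi_ac_less_if_j_eq_2 T'_eq by simp
  next
    case 3
    then show ?thesis using T.xi_ac_less_star T'_eq by simp
  next
    case 4
    \<comment> \<open>For \<open>D = 3\<close> the reversed path starts with a leaf followed by the
      non-branching \<open>v 2\<close>. Its first branching vertex is then \<open>v 1\<close>, at
      index 2, which contradicts the maximality of \<open>i = 1\<close>.\<close>
    have "D \<noteq> 3"
    proof
      assume D3: "D = 3"
      have rev: "rev P ! a = P ! (3 - a)" if "a \<le> 3" for a
        using that len D3 by (simp add: rev_nth)
      have "first_branching T (rev P) = 2"
        unfolding first_branching_def
      proof (rule Least_equality)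
        show "2 < length (rev P) \<and> branching T (rev P ! 2)"
          using rev[of 2] bi 4 len D3 by (simp add: branching_def deg)
      next
        fix a assume a: "a < length (rev P) \<and> branching T (rev P ! a)"
        show "2 \<le> a"
        proof (rule ccontr)
          assume "\<not> 2 \<le> a"
          then consider "a = 0" | "a = 1" by linarith
          then show False
            using a rev[of a] T.N_v_D D3 4 by cases (auto simp: branching_def deg)
        qed
      qed
      then show False using P_farthest T.diametric_path_rev[OF P] i 4 by fastforce
    qed
    then show ?thesis using T.xi_ac_less_if_j_eq_1 4 T'_eq by simp
  qed
qed

end
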